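(* Let $A$ be a symmetric real $p\times p$ matrix, $B$ a symmetric positive definite real $p\times p$ matrix, and $1\le k<p$. Let $(V^\ast,\rho^\ast)$ be the solution of the trace ratio problem for $(A,B)$, and assume $\lambda_k(A-\rho^\ast B)>\lambda_{k+1}(A-\rho^\ast B)$. For a matrix $U$ with orthonormal columns, of size $p\times j$ with $k\le j\le p$, let $\rho$ be the maximum value of the trace ratio problem projected onto $\mathcal U=\operatorname{span}(U)$, and let $\theta=\angle(\mathcal U,\operatorname{span}(V^\ast))\in[0,\pi/2]$. Then \[ \rho\to\rho^\ast\quad\text{as}\quad\theta\to0, \] that is, for every $\varepsilon>0$ there is $\delta>0$ such that $|\rho^\ast-\rho|<\varepsilon$ for every such $U$ with $\theta<\delta$.
   Context: The trace ratio problem for $(A,B)$ is $\max_{V\in\mathbb R^{p\times k},\,V^TV=I_k}\rho(V)$, with $\rho(V)=\operatorname{tr}(V^TAV)/\operatorname{tr}(V^TBV)$; its solution $(V^\ast,\rho^\ast)$ consists of a maximizer $V^\ast$ ($p\times k$, orthonormal columns) and the maximum value $\rho^\ast$. Eigenvalues of a symmetric $p\times p$ matrix $S$ are ordered $\lambda_1(S)\ge\dots\ge\lambda_p(S)$. The trace ratio problem projected onto $\mathcal U=\operatorname{span}(U)$ is $\rho=\max_{V=UZ,\ V^TV=I_k}\rho(V) = \max_{Z\in\mathbb R^{j\times k},\,Z^TZ=I_k}\operatorname{tr}(Z^TU^TAUZ)/\operatorname{tr}(Z^TU^TBUZ)$. The angle $\theta$ is defined by $\sin\theta=\|U_\perp^TV^\ast\|$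 (spectral norm), where the columns of $U_\perp$ form an orthonormal basis of the orthogonal complement of $\mathcal U$ (and $\sin\theta=0$ if $j=p$). *)

theory Defs
  imports "Jordan_Normal_Form.VS_Connect" "Jordan_Normal_Form.Char_Poly"
begin

definition mat_trace :: "real mat \<Rightarrow> real" where
  "mat_trace M = (\<Sum>i<dim_row M. M $$ (i, i))"

definition pos_def_mat :: "real mat \<Rightarrow> bool" where
  "pos_def_mat M \<longleftrightarrow>
     (\<forall>x\<in>carrier_vec (dim_row M). x \<noteq> 0\<^sub>v (dim_row M) \<longrightarrow> x \<bullet> (M *\<^sub>v x) > 0)"

text \<open>The i-th largest eigenvalue (1-based, counted with algebraic multiplicity).
  For a symmetric real matrix of order p the characteristic polynomial splits over the reals,
  so this is meaningful for all i between 1 and p.\<close>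
definition eigval :: "real mat \<Rightarrow> nat \<Rightarrow> real" where
  "eigval S i = rev (sorted_list_of_multiset (proots (char_poly S))) ! (i - 1)"

definition orthonormal_mats :: "nat \<Rightarrow> nat \<Rightarrow> real mat set" where
  "orthonormal_mats n m = {V \<in> carrier_mat n m. V\<^sup>T * V = 1\<^sub>m m}"

definition trace_ratio :: "real mat \<Rightarrow> real mat \<Rightarrow> real mat \<Rightarrow> real" where
  "trace_ratio A B V = mat_trace (V\<^sup>T * A * V) / mat_trace (V\<^sup>T * B * V)"

definition trace_ratio_solution ::
    "nat \<Rightarrow> nat \<Rightarrow> real mat \<Rightarrow> real mat \<Rightarrow> real mat \<Rightarrow> real \<Rightarrow> bool" where
  "trace_ratio_solution p k A B V r \<longleftrightarrow>
     V \<in> orthonormal_mats p k \<and> r = trace_ratio A B V \<and>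
     (\<forall>W\<in>orthonormal_mats p k. trace_ratio A B W \<le> r)"

definition projected_feasible :: "nat \<Rightarrow> nat \<Rightarrow> real mat \<Rightarrow> real mat set" where
  "projected_feasible p k U =
     {V \<in> orthonormal_mats p k. \<exists>Z\<in>carrier_mat (dim_col U) k. V = U * Z}"

definition projected_trace_ratio_max ::
    "nat \<Rightarrow> nat \<Rightarrow> real mat \<Rightarrow> real mat \<Rightarrow> real mat \<Rightarrow> real \<Rightarrow> bool" where
  "projected_trace_ratio_max p k A B U r \<longleftrightarrow>
     (\<exists>V\<in>projected_feasible p k U. r = trace_ratio A B V) \<and>
     (\<forall>V\<in>projected_feasible p k U. trace_ratio A B V \<le> r)"

definition vec_norm2 :: "real vec \<Rightarrow> real" where
  "vec_norm2 x = sqrt (x \<bullet> x)"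

text \<open>The supremum is over the closed unit ball rather than the unit sphere, so that the
  index set is nonempty also for matrices without columns. A matrix without rows has norm 0.\<close>
definition spectral_norm :: "real mat \<Rightarrow> real" where
  "spectral_norm M = (SUP x\<in>{x \<in> carrier_vec (dim_col M). vec_norm2 x \<le> 1}. vec_norm2 (M *\<^sub>v x))"

definition orth_compl_basis :: "nat \<Rightarrow> real mat \<Rightarrow> real mat \<Rightarrow> bool" where
  "orth_compl_basis p U W \<longleftrightarrow>
     W \<in> orthonormal_mats p (dim_col W) \<and>
     vec_space.col_space p W =
       vec_module.orthogonal_complement p (vec_space.col_space p U)"

text \<open>The angle between the column spaces of U and V (both with orthonormal columns).
  The value does not depend on which orthonormal basis of the complement is chosen. If U is
  square, the complement is trivial, the chosen matrix has no columns, and the angle is 0.\<close>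
definition subspace_angle :: "nat \<Rightarrow> real mat \<Rightarrow> real mat \<Rightarrow> real" where
  "subspace_angle p U V = arcsin (spectral_norm ((SOME W. orth_compl_basis p U W)\<^sup>T * V))"

end

(* Fix j and suppose the claim fails along frames U_n with angle tending to 0. By compactness
   U_n converges to an orthonormal L along a subsequence, and the entries of
   (I - U_n U_n^T) V* are bounded by the angle, so L L^T V* = V*. Hence Z = L^T V* has
   orthonormal columns, the U_n Z are exactly feasible, and they converge to V*; by continuity of
   the trace ratio the projected maxima do not stay below rho*. There are only finitely many j. *)
theory Submission
  imports Defs
begin

section \<open>Matrices with orthonormal columns: projection, Bessel inequality, dimension
  bound\<close>

lemma orthonormal_mats_carrier: "V \<in> orthonormal_mats n m \<Longrightarrow> V \<in> carrier_mat n m"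
  by (simp add: orthonormal_mats_def)

lemma orthonormal_mats_gram: "V \<in> orthonormal_mats n m \<Longrightarrow> V\<^sup>T * V = 1\<^sub>m m"
  by (simp add: orthonormal_mats_def)

lemma orthonormal_mats_cols:
  assumes V: "V \<in> carrier_mat n m"
  shows "V \<in> orthonormal_mats n m \<longleftrightarrow>
    (\<forall>a<m. \<forall>b<m. col V a \<bullet> col V b = (if a = b then 1 else 0))"
proof -
  have "(V\<^sup>T * V) $$ (a, b) = col V a \<bullet> col V b" if "a < m" "b < m" for a b
    using V that by simp
  then show ?thesis
    using V unfolding orthonormal_mats_def
    by (auto simp: mat_eq_iff)
qed

lemma scalar_prod_self_nonneg: "0 \<le> x \<bullet> (x :: real vec)"
  by (simp add: scalar_prod_def sum_nonneg)

lemma scalar_prod_self_eq_0: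
  assumes "x \<in> carrier_vec n" and "x \<bullet> (x :: real vec) = 0"
  shows "x = 0\<^sub>v n"
proof (rule eq_vecI)
  show "dim_vec x = dim_vec (0\<^sub>v n)" using assms by simp
  fix i assume i: "i < dim_vec (0\<^sub>v n)"
  have "(\<Sum>i<n. x $ i * x $ i) = 0"
    using assms by (simp add: scalar_prod_def lessThan_atLeast0)
  then have "\<forall>i\<in>{..<n}. x $ i * x $ i = 0"
    by (subst (asm) sum_nonneg_eq_0_iff) auto
  then show "x $ i = 0\<^sub>v n $ i" using i by simp
qed

text \<open>\<open>W * W\<^sup>T\<close> is the orthogonal projection onto the column space of
  \<open>W\<close>, so \<open>y\<close> is the component of \<open>x\<close> orthogonal to that
  space, and the third claim is Pythagoras. This one computation yields the Bessel inequality, the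
  maximality argument for complement bases and the projection error.\<close>

lemma orthonormal_mats_residual:
  assumes W: "W \<in> orthonormal_mats n m" and x: "x \<in> carrier_vec n"
  defines "y \<equiv> x - W *\<^sub>v (W\<^sup>T *\<^sub>v x)"
  shows "y \<in> carrier_vec n" and "W\<^sup>T *\<^sub>v y = 0\<^sub>v m"
    and "y \<bullet> y = x \<bullet> x - (W\<^sup>T *\<^sub>v x) \<bullet> (W\<^sup>T *\<^sub>v x)"
proof -
  note Wc = orthonormal_mats_carrier[OF W] and Wg = orthonormal_mats_gram[OF W]
  let ?u = "W\<^sup>T *\<^sub>v x"
  have u: "?u \<in> carrier_vec m" using Wc x by (intro mult_mat_vec_carrier[of _ _ n]) auto
  have Wu: "W *\<^sub>v ?u \<in> carrier_vec n" using Wc u by (rule mult_mat_vec_carrier)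
  show y: "y \<in> carrier_vec n" using x Wu by (simp add: y_def)
  have "W\<^sup>T *\<^sub>v y = ?u - W\<^sup>T *\<^sub>v (W *\<^sub>v ?u)"
    unfolding y_def using Wc x Wu by (intro mult_minus_distrib_mat_vec) auto
  also have "W\<^sup>T *\<^sub>v (W *\<^sub>v ?u) = ?u"
    using Wc Wg u by (simp flip: assoc_mult_mat_vec[of _ m n _ m])
  finally show 0: "W\<^sup>T *\<^sub>v y = 0\<^sub>v m" using u by simp
  \<comment> \<open>Moving \<open>W\<close> to the other side of the product turns every mixed term
    into one with \<open>W\<^sup>T\<close>, which is already known on \<open>x\<close> and on
    \<open>y\<close>.\<close>
  have adj: "(W *\<^sub>v ?u) \<bullet> z = ?u \<bullet> (W\<^sup>T *\<^sub>v z)" if "z \<in> carrier_vec n" for z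
    using transpose_vec_mult_scalar[of "W\<^sup>T" m n z ?u] Wc u that
    by (simp add: comm_scalar_prod[of _ n])
  have "y \<bullet> y = x \<bullet> y - (W *\<^sub>v ?u) \<bullet> y"
    by (subst (1) y_def, rule minus_scalar_prod_distrib[OF x Wu y])
  also have "(W *\<^sub>v ?u) \<bullet> y = 0" using adj[OF y] 0 u by simp
  also have "x \<bullet> y = x \<bullet> x - x \<bullet> (W *\<^sub>v ?u)"
    unfolding y_def by (rule scalar_prod_minus_distrib[OF x x Wu])
  also have "x \<bullet> (W *\<^sub>v ?u) = ?u \<bullet> ?u"
    using adj[OF x] comm_scalar_prod[OF x Wu] by simp
  finally show "y \<bullet> y = x \<bullet> x - ?u \<bullet> ?u" by simp
qed

lemma orthonormal_mats_Bessel: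
  assumes "W \<in> orthonormal_mats n m" and "x \<in> carrier_vec n"
  shows "(W\<^sup>T *\<^sub>v x) \<bullet> (W\<^sup>T *\<^sub>v x) \<le> x \<bullet> x"
  using orthonormal_mats_residual(3)[OF assms] scalar_prod_self_nonneg
  by (metis diff_ge_0_iff_ge)

lemma orthonormal_mats_isometry:
  assumes V: "V \<in> orthonormal_mats n m" and x: "x \<in> carrier_vec m"
  shows "(V *\<^sub>v x) \<bullet> (V *\<^sub>v x) = x \<bullet> x"
proof -
  note Vc = orthonormal_mats_carrier[OF V] and Vg = orthonormal_mats_gram[OF V]
  have "(V *\<^sub>v x) \<bullet> (V *\<^sub>v x) = (V\<^sup>T *\<^sub>v (V *\<^sub>v x)) \<bullet> x"
    using transpose_vec_mult_scalar[of V n m x "V *\<^sub>v x"] Vc x by simp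
  also have "V\<^sup>T *\<^sub>v (V *\<^sub>v x) = x"
    using Vc Vg x by (simp flip: assoc_mult_mat_vec[of _ m n _ m])
  finally show ?thesis .
qed

text \<open>The squared entries of \<open>W\<close> are summed in two ways. Each of the m columns
  contributes exactly 1, while each of the n rows contributes at most 1 by the Bessel inequality at
  the matching unit vector.\<close>

lemma orthonormal_mats_dim_le:
  assumes W: "W \<in> orthonormal_mats n m"
  shows "m \<le> n"
proof -
  note Wc = orthonormal_mats_carrier[OF W]
  have row: "(\<Sum>l<m. (W $$ (i, l))\<^sup>2) \<le> 1" if i: "i < n" for i
  proof -
    have "W\<^sup>T *\<^sub>v unit_vec n i = row W i"
      using Wc i by (intro eq_vecI) auto
    then have "row W i \<bullet> row W i \<le> 1"
      using orthonormal_mats_Bessel[OF W, of "unit_vec n i"] i by simp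
    then show ?thesis
      using Wc i by (simp add: scalar_prod_def lessThan_atLeast0 power2_eq_square)
  qed
  have "real m = (\<Sum>l<m. col W l \<bullet> col W l)"
    using W orthonormal_mats_cols[OF Wc] by simp
  also have "\<dots> = (\<Sum>l<m. \<Sum>i<n. (W $$ (i, l))\<^sup>2)"
    using Wc by (intro sum.cong) (auto simp: scalar_prod_def lessThan_atLeast0 power2_eq_square)
  also have "\<dots> = (\<Sum>i<n. \<Sum>l<m. (W $$ (i, l))\<^sup>2)"
    by (rule sum.swap)
  also have "\<dots> \<le> (\<Sum>i<n. 1)"
    using row by (intro sum_mono) simp
  finally show ?thesis by simp
qed

text \<open>The enlargement step of a Gram-Schmidt argument; it contradicts maximality when an
  orthonormal family does not yet span the complement.\<close>

lemma orthonormal_mats_append_col: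
  assumes W: "W \<in> orthonormal_mats n m" and z: "z \<in> carrier_vec n"
    and z1: "z \<bullet> z = 1" and Wz: "W\<^sup>T *\<^sub>v z = 0\<^sub>v m"
  defines "W' \<equiv> mat n (Suc m) (\<lambda>(i, l). if l < m then W $$ (i, l) else z $ i)"
  shows "W' \<in> orthonormal_mats n (Suc m)"
    and "\<And>l. l < m \<Longrightarrow> col W' l = col W l" and "col W' m = z"
proof -
  note Wc = orthonormal_mats_carrier[OF W]
  show a: "col W' l = col W l" if "l < m" for l
    using that Wc by (intro eq_vecI) (auto simp: W'_def)
  show b: "col W' m = z"
    using z by (intro eq_vecI) (auto simp: W'_def)
  have c: "col W l \<bullet> z = 0" if "l < m" for l
    using arg_cong[OF Wz, of "\<lambda>v. v $ l"] that Wc by simp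
  have d: "z \<bullet> col W l = 0" if "l < m" for l
    using c[OF that] comm_scalar_prod[OF z col_carrier_vec[OF that Wc]] by simp
  have "W' \<in> carrier_mat n (Suc m)" by (simp add: W'_def)
  then show "W' \<in> orthonormal_mats n (Suc m)"
    using W orthonormal_mats_cols[OF Wc] z1 c d
    by (subst orthonormal_mats_cols) (auto simp: a b less_Suc_eq)
qed

section \<open>Orthonormal bases of the orthogonal complement of a column space\<close>

lemma col_space_real_eq:
  assumes "M \<in> carrier_mat n m"
  shows "vec_space.col_space n (M :: real mat) = (*\<^sub>v) M ` carrier_vec m"
proof -
  interpret vec_space "TYPE(real)" n .
  show ?thesis using col_space_eq[OF assms] assms by auto
qed

text \<open>By adjointness, \<open>x\<close> is orthogonal to every \<open>U *\<^sub>v y\<close>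
  exactly when \<open>U\<^sup>T *\<^sub>v x\<close> is orthogonal to every \<open>y\<close>.
  Choosing \<open>y\<close> as \<open>U\<^sup>T *\<^sub>v x\<close> itself forces that vector to
  vanish. The complement thus becomes the kernel of the transpose.\<close>

lemma orthogonal_complement_col_space:
  assumes U: "U \<in> carrier_mat n j"
  shows "vec_module.orthogonal_complement n (vec_space.col_space n (U :: real mat)) =
    {x \<in> carrier_vec n. U\<^sup>T *\<^sub>v x = 0\<^sub>v j}"
proof -
  interpret vec_space "TYPE(real)" n .
  have adj: "x \<bullet> (U *\<^sub>v y) = (U\<^sup>T *\<^sub>v x) \<bullet> y"
    if "x \<in> carrier_vec n" "y \<in> carrier_vec j" for x y
    using transpose_vec_mult_scalar[OF U that(2,1)] by simp
  have "U\<^sup>T *\<^sub>v x = 0\<^sub>v j"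
    if x: "x \<in> carrier_vec n" and 0: "\<And>y. y \<in> carrier_vec j \<Longrightarrow> x \<bullet> (U *\<^sub>v y) = 0" for x
  proof -
    have u: "U\<^sup>T *\<^sub>v x \<in> carrier_vec j"
      using U x by (intro mult_mat_vec_carrier[of _ _ n]) auto
    show ?thesis using scalar_prod_self_eq_0[OF u] 0[OF u] adj[OF x u] by simp
  qed
  moreover have "x \<bullet> (U *\<^sub>v y) = 0"
    if "x \<in> carrier_vec n" "U\<^sup>T *\<^sub>v x = 0\<^sub>v j" "y \<in> carrier_vec j" for x y
    unfolding adj[OF that(1,3)] that(2) using that(3) by simp
  ultimately show ?thesis
    unfolding orthogonal_complement_def col_space_real_eq[OF U] by blast
qed

text \<open>\<open>subspace_angle\<close> selects its basis by \<open>SOME\<close>, so existence is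
  what gives the selected matrix its defining property. An orthonormal family of greatest size
  inside the kernel of \<open>U\<^sup>T\<close> works: a kernel vector outside its span would have a
  nonzero residual, which could be normalized and appended.\<close>

lemma orth_compl_basis_exists:
  assumes U: "U \<in> carrier_mat n j"
  shows "\<exists>W. orth_compl_basis n U W"
proof -
  define P where "P m \<longleftrightarrow> (\<exists>W \<in> orthonormal_mats n m. \<forall>l<m. U\<^sup>T *\<^sub>v col W l = 0\<^sub>v j)" for m
  \<comment> \<open>The matrix without columns starts the search for a greatest size and is also the
    answer when the complement is trivial. The dimension bound supplies the upper limit n.\<close>
  have "P 0"
    unfolding P_def
    by (rule bexI[of _ "mat n 0 (\<lambda>_. 0)"]) (auto simp: orthonormal_mats_cols)
  moreover have "\<forall>m. P m \<longrightarrow> m \<le> n"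
    unfolding P_def using orthonormal_mats_dim_le by blast
  ultimately obtain m where m: "P m" and max: "\<And>m'. P m' \<Longrightarrow> m' \<le> m"
    using Nat.ex_has_greatest_nat[of P 0 n] by blast
  from m obtain W where W: "W \<in> orthonormal_mats n m"
    and UW: "\<And>l. l < m \<Longrightarrow> U\<^sup>T *\<^sub>v col W l = 0\<^sub>v j"
    unfolding P_def by blast
  note Wc = orthonormal_mats_carrier[OF W]
  have "col (U\<^sup>T * W) l = 0\<^sub>v j" if "l < m" for l
    using UW[OF that] Wc U that by (subst col_mult2[of _ j n _ m]) auto
  then have "U\<^sup>T * W = 0\<^sub>m j m"
    using U Wc by (intro mat_col_eqI) auto
  then have UW0: "U\<^sup>T *\<^sub>v (W *\<^sub>v y) = 0\<^sub>v j" if "y \<in> carrier_vec m" for y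
  proof -
    have "U\<^sup>T *\<^sub>v (W *\<^sub>v y) = (U\<^sup>T * W) *\<^sub>v y"
      using U Wc that by (intro assoc_mult_mat_vec[symmetric]) auto
    also have "\<dots> = 0\<^sub>v j"
      unfolding \<open>U\<^sup>T * W = 0\<^sub>m j m\<close> using that by (intro eq_vecI) auto
    finally show ?thesis .
  qed
  have "x \<in> (*\<^sub>v) W ` carrier_vec m" if x: "x \<in> carrier_vec n" and Ux: "U\<^sup>T *\<^sub>v x = 0\<^sub>v j" for x
  proof -
    define y where "y = x - W *\<^sub>v (W\<^sup>T *\<^sub>v x)"
    note res = orthonormal_mats_residual[OF W x, folded y_def]
    have Wx: "W\<^sup>T *\<^sub>v x \<in> carrier_vec m"
      using Wc x by (intro mult_mat_vec_carrier[of _ _ n]) auto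
    have "y \<bullet> y = 0"
    proof (rule ccontr)
      assume "y \<bullet> y \<noteq> 0"
      then have pos: "0 < y \<bullet> y" using scalar_prod_self_nonneg[of y] by simp
      \<comment> \<open>The factor that normalizes the residual. The scaled residual is orthogonal
        to the columns of \<open>W\<close> and, since \<open>x\<close> and the columns of
        \<open>W\<close> are in the kernel of \<open>U\<^sup>T\<close>, lies in that kernel
        too.\<close>
      define c where "c = 1 / sqrt (y \<bullet> y)"
      have cc: "c * c * (y \<bullet> y) = 1" using pos by (simp add: c_def)
      have c0: "c \<cdot>\<^sub>v 0\<^sub>v d = 0\<^sub>v d" for d
        by (intro eq_vecI) auto
      have z: "c \<cdot>\<^sub>v y \<in> carrier_vec n" using res by simp
      have z1: "(c \<cdot>\<^sub>v y) \<bullet> (c \<cdot>\<^sub>v y) = 1" using cc by simp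
      have Wz: "W\<^sup>T *\<^sub>v (c \<cdot>\<^sub>v y) = 0\<^sub>v m"
        using mult_mat_vec[of "W\<^sup>T" m n y c] Wc res c0 by simp
      have "U\<^sup>T *\<^sub>v y = U\<^sup>T *\<^sub>v x - U\<^sup>T *\<^sub>v (W *\<^sub>v (W\<^sup>T *\<^sub>v x))"
        unfolding y_def using U Wc x by (intro mult_minus_distrib_mat_vec) auto
      then have "U\<^sup>T *\<^sub>v y = 0\<^sub>v j" using UW0[OF Wx] Ux by simp
      then have Uz: "U\<^sup>T *\<^sub>v (c \<cdot>\<^sub>v y) = 0\<^sub>v j"
        using mult_mat_vec[of "U\<^sup>T" j n y c] U res c0 by simp
      note ap = orthonormal_mats_append_col[OF W z z1 Wz]
      have "P (Suc m)"
        unfolding P_def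
      proof (intro bexI[OF _ ap(1)] allI impI)
        fix l assume "l < Suc m"
        then consider "l < m" | "l = m" by linarith
        then show "U\<^sup>T *\<^sub>v col (mat n (Suc m)
            (\<lambda>(i, l). if l < m then W $$ (i, l) else (c \<cdot>\<^sub>v y) $ i)) l = 0\<^sub>v j"
          by cases (simp_all only: ap(2,3) UW Uz)
      qed
      then show False using max by force
    qed
    then have y0: "y = 0\<^sub>v n" using scalar_prod_self_eq_0 res by blast
    have "x = W *\<^sub>v (W\<^sup>T *\<^sub>v x)"
    proof (rule eq_vecI)
      fix i assume "i < dim_vec (W *\<^sub>v (W\<^sup>T *\<^sub>v x))"
      then show "x $ i = (W *\<^sub>v (W\<^sup>T *\<^sub>v x)) $ i"
        using arg_cong[OF y0, of "\<lambda>v. v $ i"] Wc x by (simp add: y_def)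
    qed (use Wc x in auto)
    then show ?thesis using Wx by blast
  qed
  then have "(*\<^sub>v) W ` carrier_vec m = {x \<in> carrier_vec n. U\<^sup>T *\<^sub>v x = 0\<^sub>v j}"
    using UW0 Wc by auto
  then have "orth_compl_basis n U W"
    unfolding orth_compl_basis_def orthogonal_complement_col_space[OF U]
    using W Wc by (simp add: col_space_real_eq)
  then show ?thesis ..
qed

section \<open>The subspace angle as a bound on the projection error\<close>

lemma vec_norm2_orthonormal_le:
  assumes W: "W \<in> orthonormal_mats n m" and V: "V \<in> orthonormal_mats n k"
    and x: "x \<in> carrier_vec k"
  shows "vec_norm2 ((W\<^sup>T * V) *\<^sub>v x) \<le> vec_norm2 x"
proof -
  note Wc = orthonormal_mats_carrier[OF W] and Vc = orthonormal_mats_carrier[OF V]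
  have Vx: "V *\<^sub>v x \<in> carrier_vec n" using Vc x by (rule mult_mat_vec_carrier)
  have "(W\<^sup>T * V) *\<^sub>v x = W\<^sup>T *\<^sub>v (V *\<^sub>v x)"
    using Wc Vc x by (intro assoc_mult_mat_vec) auto
  then show ?thesis
    using orthonormal_mats_Bessel[OF W Vx] orthonormal_mats_isometry[OF V x]
    by (simp add: vec_norm2_def)
qed

text \<open>A real supremum bounds its members only if the set is bounded above; here the isometry
  \<open>V\<close> followed by the contraction \<open>W\<^sup>T\<close> gives the bound 1. The range
  from 0 to 1 also makes \<open>arcsin\<close> of this norm meaningful as an angle.\<close>

lemma spectral_norm_orthonormal:
  assumes W: "W \<in> orthonormal_mats n m" and V: "V \<in> orthonormal_mats n k"
  shows "x \<in> carrier_vec k \<Longrightarrow> vec_norm2 x \<le> 1 \<Longrightarrow>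
      vec_norm2 ((W\<^sup>T * V) *\<^sub>v x) \<le> spectral_norm (W\<^sup>T * V)"
    and "spectral_norm (W\<^sup>T * V) \<le> 1"
    and "0 \<le> spectral_norm (W\<^sup>T * V)"
proof -
  let ?D = "{x \<in> carrier_vec k. vec_norm2 x \<le> 1}"
  have D: "{x \<in> carrier_vec (dim_col (W\<^sup>T * V)). vec_norm2 x \<le> 1} = ?D"
    using orthonormal_mats_carrier[OF V] by simp
  have le1: "vec_norm2 ((W\<^sup>T * V) *\<^sub>v x) \<le> 1" if "x \<in> ?D" for x
    using vec_norm2_orthonormal_le[OF W V, of x] that by auto
  have zero: "0\<^sub>v k \<in> ?D" by (simp add: vec_norm2_def)
  have bdd: "bdd_above ((\<lambda>x. vec_norm2 ((W\<^sup>T * V) *\<^sub>v x)) ` ?D)"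
    using le1 by (intro bdd_aboveI2)
  have upper: "vec_norm2 ((W\<^sup>T * V) *\<^sub>v x) \<le> spectral_norm (W\<^sup>T * V)" if "x \<in> ?D" for x
    unfolding spectral_norm_def D using that bdd by (rule cSUP_upper)
  show "x \<in> carrier_vec k \<Longrightarrow> vec_norm2 x \<le> 1 \<Longrightarrow>
      vec_norm2 ((W\<^sup>T * V) *\<^sub>v x) \<le> spectral_norm (W\<^sup>T * V)"
    using upper by simp
  show "spectral_norm (W\<^sup>T * V) \<le> 1"
    unfolding spectral_norm_def D using zero le1 by (intro cSUP_least) blast+
  have "0 \<le> vec_norm2 ((W\<^sup>T * V) *\<^sub>v 0\<^sub>v k)"
    by (simp add: vec_norm2_def scalar_prod_self_nonneg)
  then show "0 \<le> spectral_norm (W\<^sup>T * V)" using upper[OF zero] by simp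
qed

text \<open>For a column v of \<open>V\<close>, the error y = v - U U^T v lies in the complement of
  the span of \<open>U\<close>. Hence y = W w with w = W^T v, and the norm of y equals that of w,
  which is at most sin(theta), hence at most theta. An entry of y is no larger than its
  norm.\<close>

lemma projection_error_le_subspace_angle:
  assumes U: "U \<in> orthonormal_mats p j" and V: "V \<in> orthonormal_mats p k"
    and a: "a < p" and b: "b < k"
  shows "\<bar>V $$ (a, b) - (U * (U\<^sup>T * V)) $$ (a, b)\<bar> \<le> subspace_angle p U V"
proof -
  note Uc = orthonormal_mats_carrier[OF U] and Vc = orthonormal_mats_carrier[OF V]
  define W where "W = (SOME W. orth_compl_basis p U W)"
  define m where "m = dim_col W"
  have "orth_compl_basis p U W"
    unfolding W_def using orth_compl_basis_exists[OF Uc] by (rule someI_ex)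
  then have W: "W \<in> orthonormal_mats p m"
    and cs: "vec_space.col_space p W = {x \<in> carrier_vec p. U\<^sup>T *\<^sub>v x = 0\<^sub>v j}"
    by (auto simp: orth_compl_basis_def m_def orthogonal_complement_col_space[OF Uc])
  note Wc = orthonormal_mats_carrier[OF W]
  define s where "s = spectral_norm (W\<^sup>T * V)"
  note sn = spectral_norm_orthonormal[OF W V, folded s_def]
  define v where "v = col V b"
  have v: "v \<in> carrier_vec p" using Vc b by (auto simp: v_def)
  define u where "u = U\<^sup>T *\<^sub>v v"
  have u: "u \<in> carrier_vec j"
    unfolding u_def using Uc v by (intro mult_mat_vec_carrier[of _ _ p]) auto
  have Uu: "U *\<^sub>v u \<in> carrier_vec p" using Uc u by (rule mult_mat_vec_carrier)
  define y where "y = v - U *\<^sub>v u"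
  note res = orthonormal_mats_residual[OF U v, folded u_def, folded y_def]
  have "y \<in> vec_space.col_space p W" unfolding cs using res by simp
  then obtain w where w: "w \<in> carrier_vec m" and yw: "y = W *\<^sub>v w"
    unfolding col_space_real_eq[OF Wc] by blast
  let ?q = "W\<^sup>T *\<^sub>v (U *\<^sub>v u)"
  have q: "?q \<in> carrier_vec m"
    using Wc by (intro mult_mat_vec_carrier[OF _ Uu]) auto
  have Wq: "W *\<^sub>v ?q \<in> carrier_vec p" using Wc q by (rule mult_mat_vec_carrier)
  have "W *\<^sub>v ?q \<in> vec_space.col_space p W"
    unfolding col_space_real_eq[OF Wc] using q by blast
  then have UWq: "U\<^sup>T *\<^sub>v (W *\<^sub>v ?q) = 0\<^sub>v j" unfolding cs by simp
  \<comment> \<open>The columns of \<open>W\<close> are orthogonal to the range of \<open>U\<close>,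
    so \<open>W\<^sup>T\<close> annihilates the projected part of v. This gives W^T y = W^T v and
    identifies the coordinates \<open>w\<close> of y.\<close>
  have "?q \<bullet> ?q = (U *\<^sub>v u) \<bullet> (W *\<^sub>v ?q)"
    by (rule transpose_vec_mult_scalar[OF Wc q Uu])
  also have "\<dots> = (W *\<^sub>v ?q) \<bullet> (U *\<^sub>v u)"
    by (rule comm_scalar_prod[OF Uu Wq])
  also have "\<dots> = 0"
    using transpose_vec_mult_scalar[OF Uc u Wq] UWq u by simp
  finally have q0: "?q = 0\<^sub>v m" using scalar_prod_self_eq_0[OF q] by simp
  have Wv: "W\<^sup>T *\<^sub>v v \<in> carrier_vec m"
    using Wc v by (intro mult_mat_vec_carrier[of _ _ p]) auto
  have "W\<^sup>T *\<^sub>v y = W\<^sup>T *\<^sub>v v - ?q"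
    unfolding y_def using Wc v Uu by (intro mult_minus_distrib_mat_vec) auto
  also have "\<dots> = W\<^sup>T *\<^sub>v v" unfolding q0 using Wv by auto
  finally have "W\<^sup>T *\<^sub>v v = W\<^sup>T *\<^sub>v (W *\<^sub>v w)" by (simp add: yw)
  also have "\<dots> = w"
    using Wc w orthonormal_mats_gram[OF W] by (simp flip: assoc_mult_mat_vec[of _ m p _ m])
  finally have ww: "W\<^sup>T *\<^sub>v v = w" .
  \<comment> \<open>Writing the column as the image of a unit vector puts \<open>w\<close> among the
    vectors over which the spectral norm takes its supremum.\<close>
  have "V *\<^sub>v unit_vec k b = v"
    using Vc b by (intro eq_vecI) (auto simp: v_def)
  moreover have "(W\<^sup>T * V) *\<^sub>v unit_vec k b = W\<^sup>T *\<^sub>v (V *\<^sub>v unit_vec k b)"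
    using Wc Vc by (intro assoc_mult_mat_vec) auto
  ultimately have "vec_norm2 w \<le> s"
    using sn(1)[of "unit_vec k b"] b by (simp add: ww vec_norm2_def)
  then have "vec_norm2 y \<le> s"
    using orthonormal_mats_isometry[OF W w] by (simp add: yw vec_norm2_def)
  moreover have "\<bar>y $ a\<bar> \<le> vec_norm2 y"
  proof -
    have "(y $ a)\<^sup>2 \<le> (\<Sum>i<p. (y $ i)\<^sup>2)"
      using a by (intro member_le_sum) auto
    also have "\<dots> = y \<bullet> y"
      using res(1) by (simp add: scalar_prod_def lessThan_atLeast0 power2_eq_square)
    finally show ?thesis
      unfolding vec_norm2_def by (metis real_sqrt_abs real_sqrt_le_iff)
  qed
  \<comment> \<open>\<open>s\<close> is the sine of the angle; sin x <= x for nonnegative x passes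
    from the sine to the angle itself.\<close>
  moreover have "s \<le> arcsin s"
  proof -
    have "s = sin (arcsin s)" using sn by simp
    also have "\<dots> \<le> arcsin s"
      using sn by (intro sin_x_le_x arcsin_nonneg) auto
    finally show ?thesis .
  qed
  moreover have "y $ a = V $$ (a, b) - (U * (U\<^sup>T * V)) $$ (a, b)"
  proof -
    have "col (U * (U\<^sup>T * V)) b = U *\<^sub>v col (U\<^sup>T * V) b"
      using Uc Vc b by (intro col_mult2[of _ p j _ k]) auto
    also have "col (U\<^sup>T * V) b = u"
      unfolding u_def v_def using Uc Vc b by (intro col_mult2[of _ j p _ k]) auto
    finally have "(U *\<^sub>v u) $ a = col (U * (U\<^sup>T * V)) b $ a" by simp
    also have "\<dots> = (U * (U\<^sup>T * V)) $$ (a, b)"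
      using Uc Vc a b by simp
    finally show ?thesis using Uu Uc Vc a b by (simp add: y_def v_def del: index_mult_mat_vec index_mult_mat(1))
  qed
  ultimately show ?thesis
    by (simp add: subspace_angle_def s_def W_def)
qed

section \<open>Entrywise convergence and sequential compactness of orthonormal frames\<close>

definition mat_tendsto :: "nat \<Rightarrow> nat \<Rightarrow> (nat \<Rightarrow> real mat) \<Rightarrow> real mat \<Rightarrow> bool" where
  "mat_tendsto n m X L \<longleftrightarrow> (\<forall>t. X t \<in> carrier_mat n m) \<and> L \<in> carrier_mat n m \<and>
     (\<forall>i<n. \<forall>j<m. (\<lambda>t. X t $$ (i, j)) \<longlonglongrightarrow> L $$ (i, j))"

lemma mat_tendsto_const: "C \<in> carrier_mat n m \<Longrightarrow> mat_tendsto n m (\<lambda>t. C) C"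
  by (simp add: mat_tendsto_def)

lemma mat_tendsto_unique:
  assumes "mat_tendsto n m X L" and "mat_tendsto n m X L'"
  shows "L = L'"
proof (rule eq_matI)
  show "L $$ (i, j) = L' $$ (i, j)" if "i < dim_row L'" and "j < dim_col L'" for i j
    using assms that unfolding mat_tendsto_def
    by (intro LIMSEQ_unique[of "\<lambda>t. X t $$ (i, j)"]) auto
qed (use assms in \<open>auto simp: mat_tendsto_def\<close>)

lemma mat_tendsto_transpose:
  "mat_tendsto n m X L \<Longrightarrow> mat_tendsto m n (\<lambda>t. (X t)\<^sup>T) L\<^sup>T"
  unfolding mat_tendsto_def carrier_mat_def by auto

lemma mat_tendsto_mult:
  assumes X: "mat_tendsto n m X L" and Y: "mat_tendsto m l Y M"
  shows "mat_tendsto n l (\<lambda>t. X t * Y t) (L * M)"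
proof -
  have entry: "(P * Q) $$ (i, j) = (\<Sum>s<m. P $$ (i, s) * Q $$ (s, j))"
    if "P \<in> carrier_mat n m" "Q \<in> carrier_mat m l" "i < n" "j < l" for P Q :: "real mat" and i j
    using that by (simp add: scalar_prod_def lessThan_atLeast0)
  show ?thesis
    using X Y unfolding mat_tendsto_def
    by (auto simp: entry intro!: tendsto_sum tendsto_mult mult_carrier_mat)
qed

lemma mat_tendsto_trace:
  assumes "mat_tendsto n n X L"
  shows "(\<lambda>t. mat_trace (X t)) \<longlonglongrightarrow> mat_trace L"
  using assms unfolding mat_tendsto_def mat_trace_def carrier_mat_def
  by (auto intro!: tendsto_sum)

lemma tendsto_trace_ratio:
  assumes A: "A \<in> carrier_mat p p" and B: "B \<in> carrier_mat p p"
    and V: "mat_tendsto p k V L" and "mat_trace (L\<^sup>T * B * L) \<noteq> 0"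
  shows "(\<lambda>t. trace_ratio A B (V t)) \<longlonglongrightarrow> trace_ratio A B L"
  unfolding trace_ratio_def
  by (intro tendsto_divide mat_tendsto_trace[of k] mat_tendsto_mult[of k p]
      mat_tendsto_transpose mat_tendsto_const assms)

text \<open>Bolzano-Weierstrass in finitely many coordinates. Each induction step refines the
  subsequence found so far to one that is monotone, hence convergent, in the new coordinate; the old
  limits survive the refinement.\<close>

lemma bounded_family_convergent_subseq:
  fixes f :: "nat \<Rightarrow> 'i \<Rightarrow> real"
  assumes "finite I" and "\<And>n i. i \<in> I \<Longrightarrow> \<bar>f n i\<bar> \<le> c"
  shows "\<exists>r l. strict_mono (r :: nat \<Rightarrow> nat) \<and> (\<forall>i\<in>I. (\<lambda>n. f (r n) i) \<longlonglongrightarrow> l i)"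
  using assms
proof (induction I)
  case empty
  show ?case by (intro exI[of _ id]) (auto simp: strict_mono_def)
next
  case (insert x I)
  then obtain r l where r: "strict_mono (r :: nat \<Rightarrow> nat)"
    and l: "\<And>i. i \<in> I \<Longrightarrow> (\<lambda>n. f (r n) i) \<longlonglongrightarrow> l i"
    by blast
  obtain r' where r': "strict_mono (r' :: nat \<Rightarrow> nat)" and "monoseq (\<lambda>n. f (r (r' n)) x)"
    using seq_monosub[of "\<lambda>n. f (r n) x"] by blast
  moreover have "Bseq (\<lambda>n. f (r (r' n)) x)"
    using insert.prems by (intro BseqI'[of _ c]) simp
  ultimately have "convergent (\<lambda>n. f (r (r' n)) x)"
    using Bseq_monoseq_convergent by blast
  then obtain y where y: "(\<lambda>n. f (r (r' n)) x) \<longlonglongrightarrow> y"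
    unfolding convergent_def by blast
  have "(\<lambda>n. f (r (r' n)) i) \<longlonglongrightarrow> l i" if "i \<in> I" for i
    using LIMSEQ_subseq_LIMSEQ[OF l[OF that] r'] by (simp add: o_def)
  then have "\<forall>i\<in>insert x I. (\<lambda>n. f ((r \<circ> r') n) i) \<longlonglongrightarrow> (l(x := y)) i"
    using y insert.hyps by auto
  moreover have "strict_mono (r \<circ> r')" using r r' by (rule strict_mono_o)
  ultimately show ?case by blast
qed

lemma orthonormal_mats_entry_le:
  assumes U: "U \<in> orthonormal_mats n m" and "i < n" and "l < m"
  shows "\<bar>U $$ (i, l)\<bar> \<le> 1"
proof -
  note Uc = orthonormal_mats_carrier[OF U]
  have "(U $$ (i, l))\<^sup>2 \<le> (\<Sum>i<n. (U $$ (i, l))\<^sup>2)"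
    using assms(2) by (intro member_le_sum) auto
  also have "\<dots> = col U l \<bullet> col U l"
    using Uc assms(3) by (simp add: scalar_prod_def lessThan_atLeast0 power2_eq_square)
  also have "\<dots> = 1"
    using U orthonormal_mats_cols[OF Uc] assms(3) by simp
  finally show ?thesis by (simp add: abs_square_le_1)
qed

text \<open>Entries of unit columns are bounded by 1, which yields an entrywise limit. The Gram
  matrices are constantly the identity, so uniqueness of limits gives the limit frame orthonormal
  columns as well.\<close>

lemma orthonormal_mats_seq_compact:
  assumes U: "\<And>t. U t \<in> orthonormal_mats n m"
  shows "\<exists>r L. strict_mono (r :: nat \<Rightarrow> nat) \<and> L \<in> orthonormal_mats n m \<and>
    mat_tendsto n m (\<lambda>t. U (r t)) L"
proof -
  have "\<bar>U t $$ i\<bar> \<le> 1" if "i \<in> {..<n} \<times> {..<m}" for t i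
    using orthonormal_mats_entry_le[OF U] that by auto
  from bounded_family_convergent_subseq[of "{..<n} \<times> {..<m}" "\<lambda>t i. U t $$ i", OF _ this]
  obtain r l where r: "strict_mono (r :: nat \<Rightarrow> nat)"
    and l: "\<forall>i \<in> {..<n} \<times> {..<m}. (\<lambda>t. U (r t) $$ i) \<longlonglongrightarrow> l i"
    by auto
  define L where "L = mat n m l"
  have lim: "mat_tendsto n m (\<lambda>t. U (r t)) L"
    using l orthonormal_mats_carrier[OF U] by (auto simp: mat_tendsto_def L_def)
  have "mat_tendsto m m (\<lambda>t. (U (r t))\<^sup>T * U (r t)) (L\<^sup>T * L)"
    by (intro mat_tendsto_mult[of _ n] mat_tendsto_transpose lim)
  then have "mat_tendsto m m (\<lambda>t. 1\<^sub>m m) (L\<^sup>T * L)"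
    by (simp add: orthonormal_mats_gram[OF U])
  then have "L\<^sup>T * L = 1\<^sub>m m"
    using mat_tendsto_unique mat_tendsto_const[OF one_carrier_mat] by blast
  then have "L \<in> orthonormal_mats n m" by (simp add: orthonormal_mats_def L_def)
  with r lim show ?thesis by blast
qed

section \<open>Positive denominators and convergence of the projected maxima\<close>

lemma mat_trace_congruence_pos:
  assumes B: "B \<in> carrier_mat p p" and pd: "pos_def_mat B"
    and V: "V \<in> orthonormal_mats p k" and k: "1 \<le> k"
  shows "0 < mat_trace (V\<^sup>T * B * V)"
proof -
  note Vc = orthonormal_mats_carrier[OF V]
  have "0 < (V\<^sup>T * B * V) $$ (i, i)" if i: "i < k" for i
  proof -
    have "V\<^sup>T * B * V = V\<^sup>T * (B * V)"
      using Vc B by (intro assoc_mult_mat) auto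
    then have "(V\<^sup>T * B * V) $$ (i, i) = col V i \<bullet> col (B * V) i"
      using Vc B i by simp
    also have "col (B * V) i = B *\<^sub>v col V i" by (rule col_mult2[OF B Vc i])
    finally have *: "(V\<^sup>T * B * V) $$ (i, i) = col V i \<bullet> (B *\<^sub>v col V i)" .
    \<comment> \<open>Each diagonal entry is the quadratic form of \<open>B\<close> at a unit, hence
      nonzero, column. With \<open>k\<close> at least 1 the trace is a nonempty sum of positive
      terms.\<close>
    have "col V i \<bullet> col V i = 1" using V orthonormal_mats_cols[OF Vc] i by simp
    then have "col V i \<noteq> 0\<^sub>v p" by auto
    moreover have "col V i \<in> carrier_vec p" using Vc by auto
    ultimately show ?thesis using pd B unfolding pos_def_mat_def * by simp
  qed
  then show ?thesis
    using k Vc unfolding mat_trace_def by (intro sum_pos) (auto simp: lessThan_empty_iff)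
qed

text \<open>The nontrivial half of the estimate. The size \<open>j\<close> is fixed because
  compactness is applied to frames of one shape, so the resulting bound on the angle may depend on
  \<open>j\<close>.\<close>

lemma projected_trace_ratio_lower:
  assumes A: "A \<in> carrier_mat p p" and B: "B \<in> carrier_mat p p"
    and V: "V \<in> orthonormal_mats p k" and nz: "mat_trace (V\<^sup>T * B * V) \<noteq> 0"
    and eps: "0 < \<epsilon>"
  shows "\<exists>\<delta>>0. \<forall>U \<rho>. U \<in> orthonormal_mats p j \<longrightarrow> projected_trace_ratio_max p k A B U \<rho> \<longrightarrow>
    subspace_angle p U V < \<delta> \<longrightarrow> trace_ratio A B V - \<epsilon> < \<rho>"
proof (rule ccontr)
  note Vc = orthonormal_mats_carrier[OF V]
  assume neg: "\<not> ?thesis"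
  have "\<exists>U \<rho>. U \<in> orthonormal_mats p j \<and> projected_trace_ratio_max p k A B U \<rho> \<and>
      subspace_angle p U V < 1 / real (Suc t) \<and> \<rho> \<le> trace_ratio A B V - \<epsilon>" for t
  proof -
    have "0 < 1 / real (Suc t)" by simp
    with neg show ?thesis by (meson not_less)
  qed
  then obtain U \<rho> where U: "\<And>t. U t \<in> orthonormal_mats p j"
    and max: "\<And>t. projected_trace_ratio_max p k A B (U t) (\<rho> t)"
    and angle: "\<And>t. subspace_angle p (U t) V < 1 / real (Suc t)"
    and le: "\<And>t. \<rho> t \<le> trace_ratio A B V - \<epsilon>"
    by metis
  obtain r L where r: "strict_mono (r :: nat \<Rightarrow> nat)" and L: "L \<in> orthonormal_mats p j"
    and lim: "mat_tendsto p j (\<lambda>t. U (r t)) L"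
    using orthonormal_mats_seq_compact[of U, OF U] by blast
  note Lc = orthonormal_mats_carrier[OF L]
  define Z where "Z = L\<^sup>T * V"
  have Z: "Z \<in> carrier_mat j k" using Lc Vc by (simp add: Z_def)
  \<comment> \<open>The angle along the subsequence is below 1/(r t + 1), and it dominates every
    entry of the projection error.\<close>
  have 0: "(\<lambda>t. V $$ (a, b) - (U (r t) * ((U (r t))\<^sup>T * V)) $$ (a, b)) \<longlonglongrightarrow> 0"
    if "a < p" "b < k" for a b
  proof (rule tendsto_0_le)
    have "\<bar>V $$ (a, b) - (U t * ((U t)\<^sup>T * V)) $$ (a, b)\<bar> \<le> 1 / real (Suc t)" for t
      using projection_error_le_subspace_angle[OF U[of t] V that] angle[of t] by linarith
    then show "\<forall>\<^sub>F t in sequentially.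
        norm (V $$ (a, b) - (U (r t) * ((U (r t))\<^sup>T * V)) $$ (a, b))
          \<le> norm (1 / real (Suc (r t))) * 1"
      by (intro always_eventually allI) simp
    show "(\<lambda>t. 1 / real (Suc (r t))) \<longlonglongrightarrow> 0"
      using LIMSEQ_subseq_LIMSEQ[OF LIMSEQ_inverse_real_of_nat r]
      by (simp add: o_def inverse_eq_divide)
  qed
  have "mat_tendsto p k (\<lambda>t. U (r t) * ((U (r t))\<^sup>T * V)) (L * Z)"
    unfolding Z_def
    by (intro mat_tendsto_mult[of _ j] mat_tendsto_mult[of _ p] mat_tendsto_transpose
        mat_tendsto_const lim Vc)
  moreover have "mat_tendsto p k (\<lambda>t. U (r t) * ((U (r t))\<^sup>T * V)) V"
  proof -
    have "(\<lambda>t. (U (r t) * ((U (r t))\<^sup>T * V)) $$ (a, b)) \<longlonglongrightarrow> V $$ (a, b)"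
      if "a < p" "b < k" for a b
      using tendsto_diff[OF tendsto_const[of "V $$ (a, b)"] 0[OF that]]
      by (simp del: index_mult_mat)
    then show ?thesis
      using calculation Vc unfolding mat_tendsto_def by blast
  qed
  \<comment> \<open>The projections of \<open>V\<close> onto the spans of the frames converge both
    to L L^T V and to \<open>V\<close>, so the span of \<open>L\<close> contains the columns of
    \<open>V\<close>.\<close>
  ultimately have LZ: "L * Z = V" by (rule mat_tendsto_unique)
  have "Z\<^sup>T = V\<^sup>T * L" using transpose_mult[of "L\<^sup>T" j p V k] Lc Vc by (simp add: Z_def)
  then have "Z\<^sup>T * Z = V\<^sup>T * (L * Z)" using Lc Vc Z by simp
  then have ZZ: "Z\<^sup>T * Z = 1\<^sub>m k" by (simp add: LZ orthonormal_mats_gram[OF V])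
  \<comment> \<open>The coefficient matrix \<open>Z\<close> is taken from the limit and does not
    vary with t. As both factors have orthonormal columns, the product is feasible exactly, without
    any correction.\<close>
  have feas: "U t * Z \<in> projected_feasible p k (U t)" for t
  proof -
    note Uc = orthonormal_mats_carrier[OF U[of t]]
    have "(U t * Z)\<^sup>T * (U t * Z) = Z\<^sup>T * ((U t)\<^sup>T * U t * Z)"
      using Uc Z by (simp add: transpose_mult[OF Uc Z] assoc_mult_mat[of _ k j _ p _ k]
          assoc_mult_mat[of _ j p _ j _ k])
    also have "\<dots> = 1\<^sub>m k" using Z ZZ by (simp add: orthonormal_mats_gram[OF U])
    finally show ?thesis
      using Uc Z unfolding projected_feasible_def orthonormal_mats_def by auto
  qed
  have "mat_tendsto p k (\<lambda>t. U (r t) * Z) V"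
    using mat_tendsto_mult[OF lim mat_tendsto_const[OF Z]] by (simp add: LZ)
  then have "(\<lambda>t. trace_ratio A B (U (r t) * Z)) \<longlonglongrightarrow> trace_ratio A B V"
    using tendsto_trace_ratio[OF A B _ nz] by blast
  moreover have "trace_ratio A B (U t * Z) \<le> trace_ratio A B V - \<epsilon>" for t
    using max[of t] feas[of t] le[of t] unfolding projected_trace_ratio_max_def by force
  \<comment> \<open>The competitors' values stay at least \<epsilon> below the value at
    \<open>V\<close>, yet they converge to it.\<close>
  ultimately have "trace_ratio A B V \<le> trace_ratio A B V - \<epsilon>"
    by (intro LIMSEQ_le_const2) auto
  with eps show False by simp
qed

theorem proposition6:
  fixes A B Vstar :: "real mat" and p k :: nat and rhostar :: real
  assumes "A \<in> carrier_mat p p" and "A\<^sup>T = A"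
    and "B \<in> carrier_mat p p" and "B\<^sup>T = B" and "pos_def_mat B"
    and "1 \<le> k" and "k < p"
    and "trace_ratio_solution p k A B Vstar rhostar"
    and "eigval (A - rhostar \<cdot>\<^sub>m B) k > eigval (A - rhostar \<cdot>\<^sub>m B) (k + 1)"
  shows "\<forall>\<epsilon>>0. \<exists>\<delta>>0. \<forall>j U \<rho>.
           k \<le> j \<longrightarrow> j \<le> p \<longrightarrow> U \<in> orthonormal_mats p j \<longrightarrow>
           projected_trace_ratio_max p k A B U \<rho> \<longrightarrow>
           subspace_angle p U Vstar < \<delta> \<longrightarrow> \<bar>rhostar - \<rho>\<bar> < \<epsilon>"
proof (intro allI impI)
  fix \<epsilon> :: real assume eps: "0 < \<epsilon>"
  have V: "Vstar \<in> orthonormal_mats p k" and rho: "rhostar = trace_ratio A B Vstar"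
    and max: "\<And>W. W \<in> orthonormal_mats p k \<Longrightarrow> trace_ratio A B W \<le> rhostar"
    using assms(8) unfolding trace_ratio_solution_def by auto
  have "mat_trace (Vstar\<^sup>T * B * Vstar) \<noteq> 0"
    using mat_trace_congruence_pos[OF assms(3,5) V assms(6)] by simp
  from projected_trace_ratio_lower[OF assms(1,3) V this eps]
  obtain d where d: "\<And>j. 0 < d j"
    and lower: "\<And>j U \<rho>. U \<in> orthonormal_mats p j \<Longrightarrow>
      projected_trace_ratio_max p k A B U \<rho> \<Longrightarrow> subspace_angle p U Vstar < d j \<Longrightarrow>
      rhostar - \<epsilon> < \<rho>"
    unfolding rho by metis
  \<comment> \<open>The sizes from \<open>k\<close> to \<open>p\<close> form a finite nonempty set,
    so the least of the size-dependent bounds is positive and serves all of them.\<close>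
  define \<delta> where "\<delta> = Min (d ` {k..p})"
  have "0 < \<delta>" unfolding \<delta>_def using d assms(7) by (subst Min_gr_iff) auto
  moreover have "\<bar>rhostar - \<rho>\<bar> < \<epsilon>"
    if j: "k \<le> j" "j \<le> p" and U: "U \<in> orthonormal_mats p j"
      and \<rho>: "projected_trace_ratio_max p k A B U \<rho>" and angle: "subspace_angle p U Vstar < \<delta>"
    for j U \<rho>
  proof -
    have "\<delta> \<le> d j" unfolding \<delta>_def using j by (intro Min_le) auto
    then have "rhostar - \<epsilon> < \<rho>" using lower[OF U \<rho>] angle by simp
    \<comment> \<open>Projection only shrinks the feasible set, so the projected maximum cannot
      exceed the global one.\<close>
    moreover have "\<rho> \<le> rhostar"
      using \<rho> max unfolding projected_trace_ratio_max_def projected_feasible_def by auto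
    ultimately show ?thesis using eps by simp
  qed
  ultimately show "\<exists>\<delta>>0. \<forall>j U \<rho>. k \<le> j \<longrightarrow> j \<le> p \<longrightarrow> U \<in> orthonormal_mats p j \<longrightarrow>
      projected_trace_ratio_max p k A B U \<rho> \<longrightarrow>
      subspace_angle p U Vstar < \<delta> \<longrightarrow> \<bar>rhostar - \<rho>\<bar> < \<epsilon>"
    by blast
qed

end
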